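(* For every 3-partite 3-graph $H$ with $R'_2(H)\geq t(H)+1$, we have $f'(H,\mathcal{L})=R'_2(H)$.
   Context: $K^{(3)}_{t,t,t}$ is the complete 3-partite 3-graph with three parts of size $t$. $t(H)$ is the minimum $t$ with $H\subseteq K^{(3)}_{t,t,t}$. $R'_2(H)$ is the minimum $n$ such that every 2-edge-coloring of $K^{(3)}_{n,n,n}$ contains a monochromatic copy of $H$; $f'(H,G)$ is the minimum $n$ such that every edge-coloring of $K^{(3)}_{n,n,n}$ with any number of colors contains a monochromatic copy of $H$ or a rainbow copy of $G$ (edges of pairwise distinct colors). The loose path $\mathcal{L}$ has edges $\{v_1v_2v_3,v_3v_4v_5,v_5v_6v_7\}$. *)

theory Defs
  imports Complex_Main "HOL-Library.Extended_Nat" "HOL-Library.FuncSet"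
begin

type_synonym 'a hypergraph = "'a set \<times> 'a set set"

abbreviation verts :: "'a hypergraph \<Rightarrow> 'a set" where "verts \<equiv> fst"
abbreviation edges :: "'a hypergraph \<Rightarrow> 'a set set" where "edges \<equiv> snd"

definition three_graph :: "'a hypergraph \<Rightarrow> bool" where
  "three_graph H \<longleftrightarrow> finite (verts H) \<and> (\<forall>e\<in>edges H. e \<subseteq> verts H \<and> card e = 3)"

definition three_partite :: "'a hypergraph \<Rightarrow> bool" where
  "three_partite H \<longleftrightarrow>
     (\<exists>A B C. A \<union> B \<union> C = verts H \<and> A \<inter> B = {} \<and> A \<inter> C = {} \<and> B \<inter> C = {} \<and>
        (\<forall>e\<in>edges H. card (e \<inter> A) = 1 \<and> card (e \<inter> B) = 1 \<and> card (e \<inter> C) = 1))"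

text \<open>\<open>K3 n\<close> is the complete 3-partite 3-graph with parts \<open>{p} \<times> {..<n}\<close> for \<open>p = 0, 1, 2\<close>.\<close>

definition K3 :: "nat \<Rightarrow> (nat \<times> nat) hypergraph" where
  "K3 n = ({..<3} \<times> {..<n}, {{(0, i), (1, j), (2, k)} | i j k. i < n \<and> j < n \<and> k < n})"

definition loose_path :: "nat hypergraph" where
  "loose_path = ({1..7}, {{1, 2, 3}, {3, 4, 5}, {5, 6, 7}})"

text \<open>\<open>copy_in H K \<phi>\<close>: the image of \<open>H\<close> under \<open>\<phi>\<close> is a (not necessarily induced) subgraph of
  \<open>K\<close> isomorphic to \<open>H\<close>.\<close>

definition copy_in :: "'a hypergraph \<Rightarrow> 'b hypergraph \<Rightarrow> ('a \<Rightarrow> 'b) \<Rightarrow> bool" where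
  "copy_in H K \<phi> \<longleftrightarrow> inj_on \<phi> (verts H) \<and> \<phi> ` verts H \<subseteq> verts K \<and> (\<forall>e\<in>edges H. \<phi> ` e \<in> edges K)"

definition has_mono_copy :: "'a hypergraph \<Rightarrow> 'b hypergraph \<Rightarrow> ('b set \<Rightarrow> nat) \<Rightarrow> bool" where
  "has_mono_copy H K \<chi> \<longleftrightarrow> (\<exists>\<phi>. copy_in H K \<phi> \<and> (\<exists>c. \<forall>e\<in>edges H. \<chi> (\<phi> ` e) = c))"

definition has_rainbow_copy :: "'a hypergraph \<Rightarrow> 'b hypergraph \<Rightarrow> ('b set \<Rightarrow> nat) \<Rightarrow> bool" where
  "has_rainbow_copy G K \<chi> \<longleftrightarrow> (\<exists>\<phi>. copy_in G K \<phi> \<and> inj_on (\<lambda>e. \<chi> (\<phi> ` e)) (edges G))"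

text \<open>The three parameters are minima of sets of natural numbers. They are taken in \<^typ>\<open>enat\<close>, so
  that the value is \<open>\<infinity>\<close> if no such number exists and an equation between them carries the
  existence of the minimum.\<close>

definition t_par :: "'a hypergraph \<Rightarrow> enat" where
  "t_par H = Inf {enat t | t. \<exists>\<phi>. copy_in H (K3 t) \<phi>}"

definition R2' :: "'a hypergraph \<Rightarrow> enat" where
  "R2' H = Inf {enat n | n. \<forall>\<chi> \<in> edges (K3 n) \<rightarrow> {..<2}. has_mono_copy H (K3 n) \<chi>}"

text \<open>Since \<^term>\<open>K3 n\<close> is finite, colours in \<^typ>\<open>nat\<close> account for any number of colours.\<close>

definition f' :: "'a hypergraph \<Rightarrow> 'b hypergraph \<Rightarrow> enat" where
  "f' H G = Inf {enat n | n. \<forall>\<chi> :: (nat \<times> nat) set \<Rightarrow> nat.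
                   has_mono_copy H (K3 n) \<chi> \<or> has_rainbow_copy G (K3 n) \<chi>}"

end

theory Submission
  imports Defs
begin

text \<open>A colouring with at most two colours contains no rainbow \<open>\<L>\<close>, so only
  \<open>f'(H, \<L>) \<le> R'\<^sub>2(H)\<close> needs an argument. Take a colouring of \<open>K\<^sub>n\<^sub>,\<^sub>n\<^sub>,\<^sub>n\<close> without rainbow
  \<open>\<L>\<close>. If it uses at most two colours, a monochromatic \<open>H\<close> exists because \<open>n = R'\<^sub>2(H)\<close>.
  If it uses three colours and \<open>n \<ge> 3\<close>, some edge \<open>e\<close> has the property that all edges disjoint
  from \<open>e\<close> have the same colour; they form a \<open>K\<^sub>n\<^sub>-\<^sub>1\<^sub>,\<^sub>n\<^sub>-\<^sub>1\<^sub>,\<^sub>n\<^sub>-\<^sub>1\<close>, which contains \<open>H\<close> since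
  \<open>t(H) \<le> n - 1\<close>. To find \<open>e\<close>, start from disjoint edges \<open>e, f\<close> of different colours (if there
  were none, everything would be monochromatic). Every edge \<open>g\<close> of a third colour shares two
  vertices with \<open>e\<close> or with \<open>f\<close>, say with \<open>e\<close>; after moving \<open>f\<close> it is disjoint from
  \<open>e \<union> g\<close>, and then every edge disjoint from \<open>e\<close> has the colour of \<open>f\<close>.\<close>

section \<open>Loose paths in coordinates\<close>

text \<open>Edges of the complete 3-partite 3-graph are coordinate triples. Up to reversal, the position
  of a loose path is determined by the part that contains three of its vertices; here it is the
  third one.\<close>

definition no_rainbow_path :: "'a set \<Rightarrow> ('a \<Rightarrow> 'a \<Rightarrow> 'a \<Rightarrow> 'c) \<Rightarrow> bool" where
  "no_rainbow_path S c \<longleftrightarrow>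
     (\<forall>x\<in>S. \<forall>x'\<in>S. \<forall>y\<in>S. \<forall>y'\<in>S. \<forall>z\<in>S. \<forall>z'\<in>S. \<forall>z''\<in>S.
        distinct [x, x'] \<longrightarrow> distinct [y, y'] \<longrightarrow> distinct [z, z', z''] \<longrightarrow>
        \<not> distinct [c x y z, c x y' z', c x' y' z''])"

text \<open>A loose path may have three vertices in any of the parts; the two permuted conjuncts
  treat the second and the first part.\<close>

definition loose_free :: "'a set \<Rightarrow> ('a \<Rightarrow> 'a \<Rightarrow> 'a \<Rightarrow> 'c) \<Rightarrow> bool" where
  "loose_free S c \<longleftrightarrow> no_rainbow_path S c \<and> no_rainbow_path S (\<lambda>x z y. c x y z)
     \<and> no_rainbow_path S (\<lambda>z y x. c x y z)"

text \<open>Reading a path backwards exchanges its two linking vertices, hence the roles of their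
  parts.\<close>

lemma no_rainbow_path_rev:
  assumes "no_rainbow_path S c"
  shows "no_rainbow_path S (\<lambda>y x z. c x y z)"
  unfolding no_rainbow_path_def
proof (intro ballI impI notI)
  fix x x' y y' z z' z''
  assume *: "x \<in> S" "x' \<in> S" "y \<in> S" "y' \<in> S" "z \<in> S" "z' \<in> S" "z'' \<in> S"
    "distinct [x, x']" "distinct [y, y']" "distinct [z, z', z'']"
    "distinct [c y x z, c y' x z', c y' x' z'']"
  then show False
    using assms[unfolded no_rainbow_path_def, rule_format, of y' y x' x z'' z' z] by auto
qed

text \<open>Exchanging two parts permutes the three conjuncts up to reversal of paths; the same
  holds for the next two lemmas.\<close>

lemma loose_free_swap23: "loose_free S c \<Longrightarrow> loose_free S (\<lambda>x z y. c x y z)"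
  unfolding loose_free_def
  using no_rainbow_path_rev[of S c] no_rainbow_path_rev[of S "\<lambda>x z y. c x y z"]
    no_rainbow_path_rev[of S "\<lambda>z y x. c x y z"]
  by simp

lemma loose_free_swap12: "loose_free S c \<Longrightarrow> loose_free S (\<lambda>y x z. c x y z)"
  unfolding loose_free_def
  using no_rainbow_path_rev[of S c] no_rainbow_path_rev[of S "\<lambda>x z y. c x y z"]
    no_rainbow_path_rev[of S "\<lambda>z y x. c x y z"]
  by simp

lemma loose_free_swap13: "loose_free S c \<Longrightarrow> loose_free S (\<lambda>z y x. c x y z)"
  unfolding loose_free_def
  using no_rainbow_path_rev[of S c] no_rainbow_path_rev[of S "\<lambda>x z y. c x y z"]
    no_rainbow_path_rev[of S "\<lambda>z y x. c x y z"]
  by simp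

text \<open>Working form of \<open>loose_free\<close>, with one conclusion for each part that can
  contain three path vertices. In a part with only two path vertices, later instantiations fill the
  remaining variable with a repeated vertex.\<close>

lemma loose_free_path:
  assumes "loose_free S c" "{x, x', x'', y, y', y'', z, z', z''} \<subseteq> S"
  shows
    "\<lbrakk>distinct [x, x']; distinct [y, y']; distinct [z, z', z'']\<rbrakk> \<Longrightarrow>
       \<not> distinct [c x y z, c x y' z', c x' y' z'']"
    "\<lbrakk>distinct [x, x']; distinct [z, z']; distinct [y, y', y'']\<rbrakk> \<Longrightarrow>
       \<not> distinct [c x y z, c x y' z', c x' y'' z']"
    "\<lbrakk>distinct [y, y']; distinct [z, z']; distinct [x, x', x'']\<rbrakk> \<Longrightarrow>
       \<not> distinct [c x y z, c x' y z', c x'' y' z']"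
proof -
  note a = assms(1)[unfolded loose_free_def]
  show "\<lbrakk>distinct [x, x']; distinct [y, y']; distinct [z, z', z'']\<rbrakk> \<Longrightarrow>
       \<not> distinct [c x y z, c x y' z', c x' y' z'']"
    using a[THEN conjunct1, unfolded no_rainbow_path_def, rule_format, of x x' y y' z z' z''] assms(2)
    by auto
  show "\<lbrakk>distinct [x, x']; distinct [z, z']; distinct [y, y', y'']\<rbrakk> \<Longrightarrow>
       \<not> distinct [c x y z, c x y' z', c x' y'' z']"
    using a[THEN conjunct2, THEN conjunct1, unfolded no_rainbow_path_def, rule_format,
        of x x' z z' y y' y''] assms(2)
    by auto
  show "\<lbrakk>distinct [y, y']; distinct [z, z']; distinct [x, x', x'']\<rbrakk> \<Longrightarrow>
       \<not> distinct [c x y z, c x' y z', c x'' y' z']"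
    using no_rainbow_path_rev[OF a[THEN conjunct2, THEN conjunct2], unfolded no_rainbow_path_def,
        rule_format, of y y' z z' x x' x''] assms(2)
    by auto
qed

section \<open>The position of an edge in a third colour\<close>

lemma no_rainbow_matching:
  assumes "loose_free S c" "{x0, x1, x2, y0, y1, y2, z0, z1, z2} \<subseteq> S"
    and "distinct [x0, x1, x2]" "distinct [y0, y1, y2]" "distinct [z0, z1, z2]"
  shows "\<not> distinct [c x0 y0 z0, c x1 y1 z1, c x2 y2 z2]"
  \<comment> \<open>The transversal edge is the middle of a loose path for each two of the three edges.\<close>
  using loose_free_path(1)[OF assms(1), of x0 x1 x1 y0 y1 y1 z0 z2 z1]
    loose_free_path(2)[OF assms(1), of x0 x2 x2 y0 y1 y2 z0 z2 z2]
    loose_free_path(3)[OF assms(1), of x1 x0 x2 y1 y2 y2 z1 z2 z2] assms(2-)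
  by auto

lemma third_element:
  assumes "\<exists>p\<in>S. \<exists>q\<in>S. \<exists>r\<in>S. distinct [p, q, r]"
  obtains w where "w \<in> S" "w \<noteq> u" "w \<noteq> v"
  using assms by (metis distinct_length_2_or_more)

text \<open>Two auxiliary edges have forced colours, because each lies on two paths with two of the
  given edges: \<open>(x1, y2, z0)\<close> has the colour of \<open>(x1, y1, z1)\<close>, and
  \<open>(x2, y1, z0)\<close> that of \<open>(x0, y0, z0)\<close>. Together with
  \<open>(x0, y2, z2)\<close> they form a rainbow path.\<close>

lemma no_rainbow_meeting_pair:
  assumes "loose_free S c" "\<exists>p\<in>S. \<exists>q\<in>S. \<exists>r\<in>S. distinct [p, q, r]"
    and "{x0, x1, y0, y1, y2, z0, z1, z2} \<subseteq> S"
    and "distinct [x0, x1]" "distinct [y0, y1, y2]" "distinct [z0, z1, z2]"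
  shows "\<not> distinct [c x0 y0 z0, c x1 y1 z1, c x0 y2 z2]"
proof
  assume d: "distinct [c x0 y0 z0, c x1 y1 z1, c x0 y2 z2]"
  obtain x2 where x2: "x2 \<in> S" "x2 \<noteq> x0" "x2 \<noteq> x1" using third_element[OF assms(2)] by metis
  note p = loose_free_path[OF assms(1)] and asm = assms(3-) x2 d
  have "c x1 y2 z0 = c x1 y1 z1"
    using p(2)[of x1 x0 x0 y1 y2 y0 z1 z0 z0] p(1)[of x1 x0 x0 y1 y2 y2 z1 z0 z2] asm by auto
  moreover have "c x2 y1 z0 = c x0 y0 z0"
    using p(3)[of x1 x2 x0 y1 y0 y0 z1 z0 z0] p(2)[of x0 x2 x2 y2 y0 y1 z2 z0 z0] asm by auto
  ultimately show False
    using p(3)[of x0 x1 x2 y2 y1 y1 z2 z0 z0] asm by auto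
qed

text \<open>Hamming distance at most 1.\<close>

definition near :: "'a \<Rightarrow> 'a \<Rightarrow> 'a \<Rightarrow> 'a \<Rightarrow> 'a \<Rightarrow> 'a \<Rightarrow> bool" where
  "near x y z x' y' z' \<longleftrightarrow> x = x' \<and> y = y' \<or> x = x' \<and> z = z' \<or> y = y' \<and> z = z'"

text \<open>Sort by the vertices that the third edge shares with the other two. None: a rainbow
  matching (\<open>m\<close>). Exactly one in total: a meeting pair with a disjoint edge (the facts
  \<open>n01\<close> to \<open>n13\<close>). Exactly one with each: the third edge is the middle of
  a rainbow path (\<open>q01\<close> to \<open>q13\<close>). In all other cases it shares two
  vertices with one of them.\<close>

lemma third_colour_near:
  assumes lf: "loose_free S c" and S3: "\<exists>p\<in>S. \<exists>q\<in>S. \<exists>r\<in>S. distinct [p, q, r]"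
    and S: "{x0, x1, x, y0, y1, y, z0, z1, z} \<subseteq> S"
    and ne: "x0 \<noteq> x1" "y0 \<noteq> y1" "z0 \<noteq> z1"
    and d: "distinct [c x0 y0 z0, c x1 y1 z1, c x y z]"
  shows "near x y z x0 y0 z0 \<or> near x y z x1 y1 z1"
proof (rule ccontr)
  assume far: "\<not> ?thesis"
  note p = loose_free_path[OF lf]
    and n = no_rainbow_meeting_pair[OF lf S3]
      no_rainbow_meeting_pair[OF loose_free_swap12[OF lf] S3]
      no_rainbow_meeting_pair[OF loose_free_swap13[OF lf] S3]
  have m: False if "x \<noteq> x0" "x \<noteq> x1" "y \<noteq> y0" "y \<noteq> y1" "z \<noteq> z0" "z \<noteq> z1"
    using no_rainbow_matching[OF lf S] S ne d that by auto
  have n01: False if "x = x0" "y \<noteq> y0" "y \<noteq> y1" "z \<noteq> z0" "z \<noteq> z1"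
    using n(1)[of x0 x1 y0 y1 y z0 z1 z] S ne d that by auto
  have n02: False if "x \<noteq> x0" "x \<noteq> x1" "y = y0" "z \<noteq> z0" "z \<noteq> z1"
    using n(2)[of y0 y1 x0 x1 x z0 z1 z] S ne d that by auto
  have n03: False if "x \<noteq> x0" "x \<noteq> x1" "y \<noteq> y0" "y \<noteq> y1" "z = z0"
    using n(3)[of z0 z1 y0 y1 y x0 x1 x] S ne d that by auto
  have q01: False if "x = x0" "y = y1" "z \<noteq> z0" "z \<noteq> z1"
    using p(1)[of x0 x1 x1 y0 y1 y1 z0 z z1] S ne d that by auto
  have q02: False if "x = x0" "z = z1" "y \<noteq> y0" "y \<noteq> y1"
    using p(2)[of x0 x1 x1 y0 y y1 z0 z1 z1] S ne d that by auto
  have q03: False if "y = y0" "z = z1" "x \<noteq> x0" "x \<noteq> x1"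
    using p(3)[of x0 x x1 y0 y1 y1 z0 z1 z1] S ne d that by auto
  have n11: False if "x = x1" "y \<noteq> y0" "y \<noteq> y1" "z \<noteq> z0" "z \<noteq> z1"
    using n(1)[of x1 x0 y1 y0 y z1 z0 z] S ne d that by auto
  have n12: False if "x \<noteq> x0" "x \<noteq> x1" "y = y1" "z \<noteq> z0" "z \<noteq> z1"
    using n(2)[of y1 y0 x1 x0 x z1 z0 z] S ne d that by auto
  have n13: False if "x \<noteq> x0" "x \<noteq> x1" "y \<noteq> y0" "y \<noteq> y1" "z = z1"
    using n(3)[of z1 z0 y1 y0 y x1 x0 x] S ne d that by auto
  have q11: False if "x = x1" "y = y0" "z \<noteq> z0" "z \<noteq> z1"
    using p(1)[of x1 x0 x0 y1 y0 y0 z1 z z0] S ne d that by auto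
  have q12: False if "x = x1" "z = z0" "y \<noteq> y0" "y \<noteq> y1"
    using p(2)[of x1 x0 x0 y1 y y0 z1 z0 z0] S ne d that by auto
  have q13: False if "y = y1" "z = z0" "x \<noteq> x0" "x \<noteq> x1"
    using p(3)[of x1 x x0 y1 y0 y0 z1 z0 z0] S ne d that by auto
  show False
    using far ne m n01 n02 n03 q01 q02 q03 n11 n12 n13 q11 q12 q13
    unfolding near_def by metis
qed

section \<open>An edge off which the colouring is constant\<close>

definition mono_off_edge :: "'a set \<Rightarrow> ('a \<Rightarrow> 'a \<Rightarrow> 'a \<Rightarrow> 'c) \<Rightarrow> bool" where
  "mono_off_edge S c \<longleftrightarrow> (\<exists>a\<in>S. \<exists>b\<in>S. \<exists>d\<in>S. \<exists>k.
     \<forall>x\<in>S - {a}. \<forall>y\<in>S - {b}. \<forall>z\<in>S - {d}. c x y z = k)"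

lemma mono_off_edge_swap:
  "mono_off_edge S (\<lambda>x z y. c x y z) \<Longrightarrow> mono_off_edge S c"
  "mono_off_edge S (\<lambda>z y x. c x y z) \<Longrightarrow> mono_off_edge S c"
  unfolding mono_off_edge_def by blast+

lemma mono_off_edge_of_disjoint:
  assumes lf: "loose_free S c" and S3: "\<exists>p\<in>S. \<exists>q\<in>S. \<exists>r\<in>S. distinct [p, q, r]"
    and S: "{x0, x1, y0, y1, z0, z1, z2} \<subseteq> S"
    and ne: "x0 \<noteq> x1" "y0 \<noteq> y1" "distinct [z0, z1, z2]"
    and d: "distinct [c x0 y0 z0, c x1 y1 z1, c x0 y0 z2]"
  shows "mono_off_edge S c"
proof -
  note p = loose_free_path[OF lf] and A = third_colour_near[OF lf S3]
  obtain x2 where x2: "x2 \<in> S" "x2 \<noteq> x0" "x2 \<noteq> x1" using third_element[OF S3] by metis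
  obtain y2 where y2: "y2 \<in> S" "y2 \<noteq> y0" "y2 \<noteq> y1" using third_element[OF S3] by metis
  let ?k = "c x1 y1 z1"
  \<comment> \<open>This edge is the middle of a path from \<open>(x1, y1, z1)\<close> to each of
    \<open>(x0, y0, z0)\<close> and \<open>(x0, y0, z2)\<close>, so its colour lies in two pairs
    that have only \<open>?k\<close> in common. The same works for \<open>k2\<close>.\<close>
  have k1: "c x0 y2 z1 = ?k"
    using p(2)[of x0 x1 x1 y0 y2 y1 z0 z1 z1] p(2)[of x0 x1 x1 y0 y2 y1 z2 z1 z1] S ne d y2 by auto
  have k2: "c x2 y0 z1 = ?k"
    using p(3)[of x0 x2 x1 y0 y1 y1 z0 z1 z1] p(3)[of x0 x2 x1 y0 y1 y1 z2 z1 z1] S ne d x2 by auto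
  \<comment> \<open>An edge \<open>(x, y, z)\<close> of another colour forms, with some
    \<open>(x0, y0, w)\<close>, a disjoint pair in two colours other than \<open>?k\<close>, so the
    three known edges of colour \<open>?k\<close> are near this pair. Those of \<open>k1\<close> and
    \<open>k2\<close> force \<open>(x, y, z) = (x2, y2, z1)\<close>, which is not near
    \<open>(x1, y1, z1)\<close>.\<close>
  have off: "c x y z = ?k" if h: "x \<in> S" "y \<in> S" "z \<in> S" "x \<noteq> x0" "y \<noteq> y0" "z \<noteq> z0" "z \<noteq> z2" for x y z
  proof (rule ccontr)
    assume nk: "c x y z \<noteq> ?k"
    obtain w where w: "w = z0 \<or> w = z2" "c x y z \<noteq> c x0 y0 w"
      using d that[of z0] that[of z2] by (metis distinct_length_2_or_more)
    have "near u v s x0 y0 w \<or> near u v s x y z" if "u \<in> S" "v \<in> S" "s \<in> S" "c u v s = ?k" for u v s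
      using A[of x0 x u y0 y v w z s] that h nk w S d by auto
    from this[of x1 y1 z1] this[OF _ _ _ k1] this[OF _ _ _ k2]
    show False using h w S ne x2 y2 unfolding near_def by auto
  qed
  \<comment> \<open>Edges through \<open>z2\<close> remain. If such an edge has the colour of
    \<open>(x0, y0, z2)\<close>, then it forms a two-coloured disjoint pair with
    \<open>(x0, y0, z0)\<close>, and \<open>off\<close> supplies an edge of colour \<open>?k\<close>
    far from both. Otherwise a path through \<open>(x, y, z2)\<close> to \<open>(x0, y0, z2)\<close>
    is rainbow.\<close>
  have on: "c x y z2 = ?k" if h: "x \<in> S" "y \<in> S" "x \<noteq> x0" "y \<noteq> y0" for x y
  proof (rule ccontr)
    assume nk: "c x y z2 \<noteq> ?k"
    obtain y' where y': "y' \<in> S" "y' \<noteq> y0" "y' \<noteq> y" using third_element[OF S3] by metis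
    obtain x' where x': "x' \<in> S" "x' \<noteq> x0" "x' \<noteq> x" using third_element[OF S3] by metis
    show False
    proof (cases "c x y z2 = c x0 y0 z2")
      case True
      then have "near x' y' z1 x0 y0 z0 \<or> near x' y' z1 x y z2"
        using A[of x0 x x' y0 y y' z0 z2 z1] off[of x' y' z1] h nk S ne d x' y' by auto
      then show False using x' y' ne unfolding near_def by auto
    next
      case False
      then show False
        using p(2)[of x x0 x0 y' y y0 z1 z2 z2] off[of x y' z1] h nk S ne d y' by auto
    qed
  qed
  show ?thesis unfolding mono_off_edge_def
  proof (intro bexI exI ballI)
    show "c x y z = ?k" if "x \<in> S - {x0}" "y \<in> S - {y0}" "z \<in> S - {z0}" for x y z
      using off[of x y z] on[of x y] that by (cases "z = z2") auto
  qed (use S in auto)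
qed

lemma mono_off_edge_of_line:
  assumes lf: "loose_free S c" and S3: "\<exists>p\<in>S. \<exists>q\<in>S. \<exists>r\<in>S. distinct [p, q, r]"
    and S: "{x0, x1, y0, y1, z0, z1, z} \<subseteq> S"
    and ne: "x0 \<noteq> x1" "y0 \<noteq> y1" "z0 \<noteq> z1"
    and d: "distinct [c x0 y0 z0, c x1 y1 z1, c x0 y0 z]"
  shows "mono_off_edge S c"
proof (cases "z = z1")
  case False
  then show ?thesis using mono_off_edge_of_disjoint[OF lf S3 S] ne d by auto
next
  case z: True
  obtain y2 where y2: "y2 \<in> S" "y2 \<noteq> y0" "y2 \<noteq> y1" using third_element[OF S3] by metis
  obtain z2 where z2: "z2 \<in> S" "z2 \<noteq> z0" "z2 \<noteq> z1" using third_element[OF S3] by metis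
  \<comment> \<open>Move the second edge off the line: the edge found here misses both edges on it.\<close>
  have "c x1 y2 z2 \<noteq> c x0 y0 z"
    using third_colour_near[OF lf S3, of x0 x1 x1 y0 y1 y2 z0 z1 z2] y2 z2 S ne d
    unfolding near_def by auto
  moreover have "c x1 y2 z2 \<in> {c x1 y1 z1, c x0 y0 z}"
    using loose_free_path(2)[OF lf, of x1 x0 x0 y2 y1 y0 z2 z1 z1] y2 z2 z S ne d by auto
  ultimately have "c x1 y2 z2 = c x1 y1 z1" by simp
  then show ?thesis
    using mono_off_edge_of_disjoint[OF lf S3, of x0 x1 y0 y2 z0 z2 z] y2 z2 z S ne d by auto
qed

text \<open>A permutation of the parts moves the coordinate in which the two near edges differ to
  the third place.\<close>

lemma mono_off_edge_of_near:
  assumes lf: "loose_free S c" and S3: "\<exists>p\<in>S. \<exists>q\<in>S. \<exists>r\<in>S. distinct [p, q, r]"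
    and S: "{x0, x1, x, y0, y1, y, z0, z1, z} \<subseteq> S"
    and ne: "x0 \<noteq> x1" "y0 \<noteq> y1" "z0 \<noteq> z1"
    and d: "distinct [c x0 y0 z0, c x1 y1 z1, c x y z]"
    and near: "near x y z x0 y0 z0"
  shows "mono_off_edge S c"
  using near unfolding near_def
proof (elim disjE conjE)
  assume "x = x0" "y = y0"
  then show ?thesis using mono_off_edge_of_line[OF lf S3, of x0 x1 y0 y1 z0 z1 z] S ne d by auto
next
  assume "x = x0" "z = z0"
  then have "mono_off_edge S (\<lambda>x z y. c x y z)"
    using mono_off_edge_of_line[OF loose_free_swap23[OF lf] S3, of x0 x1 z0 z1 y0 y1 y] S ne d
    by auto
  then show ?thesis by (rule mono_off_edge_swap)
next
  assume "y = y0" "z = z0"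
  then have "mono_off_edge S (\<lambda>z y x. c x y z)"
    using mono_off_edge_of_line[OF loose_free_swap13[OF lf] S3, of z0 z1 y0 y1 x0 x1 x] S ne d
    by auto
  then show ?thesis by (rule mono_off_edge_swap)
qed

proposition mono_off_edge_of_three_colours:
  assumes lf: "loose_free S c" and S3: "\<exists>p\<in>S. \<exists>q\<in>S. \<exists>r\<in>S. distinct [p, q, r]"
    and three: "\<And>k l. \<exists>x\<in>S. \<exists>y\<in>S. \<exists>z\<in>S. c x y z \<noteq> k \<and> c x y z \<noteq> l"
  shows "mono_off_edge S c"
proof -
  obtain x0 y0 z0 x1 y1 z1 where *: "{x0, x1, y0, y1, z0, z1} \<subseteq> S"
    "x0 \<noteq> x1" "y0 \<noteq> y1" "z0 \<noteq> z1" "c x0 y0 z0 \<noteq> c x1 y1 z1"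
  proof -
    obtain a b d where a: "a \<in> S" "b \<in> S" "d \<in> S" using S3 by blast
    obtain a' b' d' where a': "a' \<in> S" "b' \<in> S" "d' \<in> S" "c a' b' d' \<noteq> c a b d"
      using three by metis
    \<comment> \<open>The edge \<open>(x, y, z)\<close> is disjoint from both chosen edges and
      differs in colour from at least one of them.\<close>
    obtain x where x: "x \<in> S" "x \<noteq> a" "x \<noteq> a'" using third_element[OF S3] by metis
    obtain y where y: "y \<in> S" "y \<noteq> b" "y \<noteq> b'" using third_element[OF S3] by metis
    obtain z where z: "z \<in> S" "z \<noteq> d" "z \<noteq> d'" using third_element[OF S3] by metis
    show ?thesis
      using that[of a x b y d z] that[of a' x b' y d' z] a a' x y z by (cases "c x y z = c a b d") auto
  qed
  obtain x y z where g: "x \<in> S" "y \<in> S" "z \<in> S" "c x y z \<noteq> c x0 y0 z0" "c x y z \<noteq> c x1 y1 z1"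
    using three by metis
  have "near x y z x0 y0 z0 \<or> near x y z x1 y1 z1"
    by (rule third_colour_near[OF lf S3]) (use * g in auto)
  then show ?thesis
  proof
    assume "near x y z x0 y0 z0"
    then show ?thesis
      by (intro mono_off_edge_of_near[OF lf S3, of x0 x1 x y0 y1 y z0 z1 z]) (use * g in auto)
  next
    assume "near x y z x1 y1 z1"
    then show ?thesis
      by (intro mono_off_edge_of_near[OF lf S3, of x1 x0 x y1 y0 y z1 z0 z]) (use * g in auto)
  qed
qed

section \<open>Translation between \<open>K3 n\<close> and coordinate triples\<close>

definition edge_of :: "nat \<Rightarrow> nat \<Rightarrow> nat \<Rightarrow> (nat \<times> nat) set" where
  "edge_of i j k = {(0, i), (1, j), (2, k)}"

lemma edges_K3: "edges (K3 n) = {edge_of i j k | i j k. i < n \<and> j < n \<and> k < n}"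
  unfolding K3_def edge_of_def by simp

lemma rainbow_loose_pathI:
  assumes "distinct [v1, v2, v3, v4, v5, v6, v7]" "set [v1, v2, v3, v4, v5, v6, v7] \<subseteq> verts K"
    and "{{v1, v2, v3}, {v3, v4, v5}, {v5, v6, v7}} \<subseteq> edges K"
    and "distinct [\<chi> {v1, v2, v3}, \<chi> {v3, v4, v5}, \<chi> {v5, v6, v7}]"
  shows "has_rainbow_copy loose_path K \<chi>"
proof -
  \<comment> \<open>The path's vertices are numbered from 1, list positions from 0.\<close>
  define \<phi> where "\<phi> i = [v1, v2, v3, v4, v5, v6, v7] ! (i - 1)" for i :: nat
  have *: "\<phi> 1 = v1" "\<phi> 2 = v2" "\<phi> 3 = v3" "\<phi> 4 = v4" "\<phi> 5 = v5" "\<phi> 6 = v6" "\<phi> 7 = v7"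
    unfolding \<phi>_def by (simp_all add: numeral_eq_Suc)
  have V: "{1..7::nat} = {1, 2, 3, 4, 5, 6, 7}" by auto
  have "inj_on \<phi> {1..7}"
  proof (rule inj_onI)
    fix i j assume ij: "i \<in> {1..7}" "j \<in> {1..7}" "\<phi> i = \<phi> j"
    then have "i - 1 < length [v1, v2, v3, v4, v5, v6, v7]" "j - 1 < length [v1, v2, v3, v4, v5, v6, v7]"
      by auto
    then have "i - 1 = j - 1"
      using nth_eq_iff_index_eq[OF assms(1), of "i - 1" "j - 1"] ij(3) unfolding \<phi>_def by blast
    with ij show "i = j" by auto
  qed
  moreover have "\<phi> ` {1..7} \<subseteq> verts K" using assms(2) by (simp add: V * del: One_nat_def)
  ultimately have "copy_in loose_path K \<phi>"
    using assms(3) by (simp add: copy_in_def loose_path_def * del: One_nat_def)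
  moreover have "inj_on (\<lambda>e. \<chi> (\<phi> ` e)) (edges loose_path)"
    unfolding loose_path_def snd_conv inj_on_insert
    using assms(4) by (auto simp: * simp del: One_nat_def)
  ultimately show ?thesis unfolding has_rainbow_copy_def by blast
qed

text \<open>Each forbidden coordinate pattern is an actual loose path once its vertices are listed
  with the two linking vertices in positions 3 and 5.\<close>

lemma loose_free_of_no_rainbow_copy:
  assumes "\<not> has_rainbow_copy loose_path (K3 n) \<chi>"
  shows "loose_free {..<n} (\<lambda>i j k. \<chi> (edge_of i j k))"
proof -
  have V: "verts (K3 n) = {..<3} \<times> {..<n}" by (simp add: K3_def)
  have e: "edge_of i j k \<in> edges (K3 n)" if "i < n" "j < n" "k < n" for i j k
    using that unfolding edges_K3 by blast
  have "no_rainbow_path {..<n} (\<lambda>i j k. \<chi> (edge_of i j k))"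
    unfolding no_rainbow_path_def
  proof (intro ballI impI notI)
    fix x x' y y' z z' z''
    assume *: "x \<in> {..<n}" "x' \<in> {..<n}" "y \<in> {..<n}" "y' \<in> {..<n}" "z \<in> {..<n}" "z' \<in> {..<n}" "z'' \<in> {..<n}"
      "distinct [x, x']" "distinct [y, y']" "distinct [z, z', z'']"
      and d: "distinct [\<chi> (edge_of x y z), \<chi> (edge_of x y' z'), \<chi> (edge_of x' y' z'')]"
    have eq: "{(1, y), (2, z), (0, x)} = edge_of x y z" "{(0, x), (2, z'), (1, y')} = edge_of x y' z'"
      "{(1, y'), (0, x'), (2, z'')} = edge_of x' y' z''" unfolding edge_of_def by (simp_all add: insert_commute)
    have "has_rainbow_copy loose_path (K3 n) \<chi>"
      by (rule rainbow_loose_pathI[of "(1, y)" "(2, z)" "(0, x)" "(2, z')" "(1, y')" "(0, x')" "(2, z'')"])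
        (unfold eq V, use * d in \<open>simp_all add: e\<close>)
    with assms show False ..
  qed
  moreover have "no_rainbow_path {..<n} (\<lambda>i k j. \<chi> (edge_of i j k))"
    unfolding no_rainbow_path_def
  proof (intro ballI impI notI)
    fix x x' z z' y y' y''
    assume *: "x \<in> {..<n}" "x' \<in> {..<n}" "z \<in> {..<n}" "z' \<in> {..<n}" "y \<in> {..<n}" "y' \<in> {..<n}" "y'' \<in> {..<n}"
      "distinct [x, x']" "distinct [z, z']" "distinct [y, y', y'']"
      and d: "distinct [\<chi> (edge_of x y z), \<chi> (edge_of x y' z'), \<chi> (edge_of x' y'' z')]"
    have eq: "{(1, y), (2, z), (0, x)} = edge_of x y z" "{(0, x), (1, y'), (2, z')} = edge_of x y' z'"
      "{(2, z'), (0, x'), (1, y'')} = edge_of x' y'' z'" unfolding edge_of_def by (simp_all add: insert_commute)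
    have "has_rainbow_copy loose_path (K3 n) \<chi>"
      by (rule rainbow_loose_pathI[of "(1, y)" "(2, z)" "(0, x)" "(1, y')" "(2, z')" "(0, x')" "(1, y'')"])
        (unfold eq V, use * d in \<open>simp_all add: e\<close>)
    with assms show False ..
  qed
  moreover have "no_rainbow_path {..<n} (\<lambda>k j i. \<chi> (edge_of i j k))"
    unfolding no_rainbow_path_def
  proof (intro ballI impI notI)
    fix z z' y y' x x' x''
    assume *: "z \<in> {..<n}" "z' \<in> {..<n}" "y \<in> {..<n}" "y' \<in> {..<n}" "x \<in> {..<n}" "x' \<in> {..<n}" "x'' \<in> {..<n}"
      "distinct [z, z']" "distinct [y, y']" "distinct [x, x', x'']"
      and d: "distinct [\<chi> (edge_of x y z), \<chi> (edge_of x' y' z), \<chi> (edge_of x'' y' z')]"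
    have eq: "{(0, x), (1, y), (2, z)} = edge_of x y z" "{(2, z), (0, x'), (1, y')} = edge_of x' y' z"
      "{(1, y'), (0, x''), (2, z')} = edge_of x'' y' z'" unfolding edge_of_def by (simp_all add: insert_commute)
    have "has_rainbow_copy loose_path (K3 n) \<chi>"
      by (rule rainbow_loose_pathI[of "(0, x)" "(1, y)" "(2, z)" "(0, x')" "(1, y')" "(0, x'')" "(2, z')"])
        (unfold eq V, use * d in \<open>simp_all add: e\<close>)
    with assms show False ..
  qed
  ultimately show ?thesis unfolding loose_free_def by (intro conjI)
qed

text \<open>Pigeonhole: three edges, two colours.\<close>

lemma no_rainbow_copy_two_colours:
  assumes "\<chi> \<in> edges K \<rightarrow> {..<2}"
  shows "\<not> has_rainbow_copy loose_path K \<chi>"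
proof
  assume "has_rainbow_copy loose_path K \<chi>"
  then obtain \<phi> where *: "copy_in loose_path K \<phi>" "inj_on (\<lambda>e. \<chi> (\<phi> ` e)) (edges loose_path)"
    unfolding has_rainbow_copy_def by blast
  have "{1, 2, 3} \<noteq> {3, 4, 5::nat}" "{1, 2, 3} \<noteq> {5, 6, 7::nat}" "{3, 4, 5} \<noteq> {5, 6, 7::nat}"
    by (simp_all add: set_eq_subset)
  then have "card (edges loose_path) = 3" unfolding loose_path_def by simp
  moreover have "(\<lambda>e. \<chi> (\<phi> ` e)) ` edges loose_path \<subseteq> {..<2}"
    using * assms unfolding copy_in_def by auto
  then have "card (edges loose_path) \<le> card {..<2::nat}"
    using * card_inj_on_le by blast
  ultimately show False by simp
qed

section \<open>Monochromatic copies of \<open>H\<close>\<close>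

lemma copy_in_trans:
  assumes "copy_in H K \<phi>" "copy_in K M \<psi>"
  shows "copy_in H M (\<psi> \<circ> \<phi>)"
proof -
  have "inj_on (\<psi> \<circ> \<phi>) (verts H)"
    using assms unfolding copy_in_def by (meson comp_inj_on inj_on_subset)
  then show ?thesis using assms unfolding copy_in_def image_comp[symmetric] by blast
qed

text \<open>The increasing enumeration of the natural numbers other than \<open>a\<close>.\<close>

definition skip :: "nat \<Rightarrow> nat \<Rightarrow> nat" where
  "skip a i = (if i < a then i else Suc i)"

lemma skip_less: "i < t \<Longrightarrow> t + 1 \<le> n \<Longrightarrow> skip a i < n"
  unfolding skip_def by simp

lemma skip_inject: "skip a i = skip a j \<Longrightarrow> i = j"
  unfolding skip_def by (simp split: if_splits)

lemma image_skip_edge_of: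
  "(\<lambda>(p, i). (p, skip (a p) i)) ` edge_of i j k = edge_of (skip (a 0) i) (skip (a 1) j) (skip (a 2) k)"
  unfolding edge_of_def by simp

lemma copy_in_K3_skip:
  assumes "t + 1 \<le> n"
  shows "copy_in (K3 t) (K3 n) (\<lambda>(p, i). (p, skip (a p) i))" (is "copy_in _ _ ?\<psi>")
proof -
  have "inj_on ?\<psi> (verts (K3 t))"
    by (rule inj_onI) (auto dest: skip_inject)
  moreover have "?\<psi> ` verts (K3 t) \<subseteq> verts (K3 n)"
    using skip_less assms unfolding K3_def by auto
  moreover have "?\<psi> ` f \<in> edges (K3 n)" if "f \<in> edges (K3 t)" for f
  proof -
    obtain i j k where f: "f = edge_of i j k" "i < t" "j < t" "k < t"
      using \<open>f \<in> edges (K3 t)\<close> unfolding edges_K3 by blast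
    show ?thesis
      unfolding f(1) image_skip_edge_of edges_K3 using f(2-) skip_less[OF _ assms] by blast
  qed
  ultimately show ?thesis unfolding copy_in_def by blast
qed

text \<open>Skipping one vertex of the exceptional edge in each part embeds \<open>K3 t\<close> into
  the edges disjoint from it, which all have one colour.\<close>

lemma mono_copy_of_mono_off_edge:
  assumes "copy_in H (K3 t) \<phi>" "t + 1 \<le> n"
    and "mono_off_edge {..<n} (\<lambda>i j k. \<chi> (edge_of i j k))"
  shows "has_mono_copy H (K3 n) \<chi>"
proof -
  obtain a b d m where m: "\<And>x y z. x < n \<Longrightarrow> y < n \<Longrightarrow> z < n \<Longrightarrow> x \<noteq> a \<Longrightarrow> y \<noteq> b \<Longrightarrow> z \<noteq> d \<Longrightarrow>
      \<chi> (edge_of x y z) = m"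
    using assms(3) unfolding mono_off_edge_def by (metis Diff_iff lessThan_iff singletonD)
  define \<psi> where "\<psi> = (\<lambda>(p, i). (p, skip (if p = 0 then a else if p = (1::nat) then b else d) i))"
  have \<psi>: "copy_in (K3 t) (K3 n) \<psi>" unfolding \<psi>_def by (rule copy_in_K3_skip) fact
  have "\<chi> (\<psi> ` f) = m" if "f \<in> edges (K3 t)" for f
  proof -
    obtain i j k where f: "f = edge_of i j k" "i < t" "j < t" "k < t"
      using \<open>f \<in> edges (K3 t)\<close> unfolding edges_K3 by blast
    then have "\<psi> ` f = edge_of (skip a i) (skip b j) (skip d k)"
      unfolding \<psi>_def by (simp add: image_skip_edge_of)
    then show ?thesis using m[of "skip a i" "skip b j" "skip d k"] f assms(2)
      by (auto simp: skip_def)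
  qed
  then have "\<forall>e\<in>edges H. \<chi> ((\<psi> \<circ> \<phi>) ` e) = m"
    using assms(1) unfolding copy_in_def image_comp[symmetric] by blast
  then show ?thesis using copy_in_trans[OF assms(1) \<psi>] unfolding has_mono_copy_def by blast
qed

text \<open>For such \<open>t\<close>, \<open>K3 t\<close> has at most one edge, so every copy of
  \<open>H\<close> inside it is monochromatic.\<close>

lemma mono_copy_of_le_1:
  assumes "copy_in H (K3 t) \<phi>" "t \<le> 1" "t + 1 \<le> n"
  shows "has_mono_copy H (K3 n) \<chi>"
proof -
  \<comment> \<open>Skipping \<open>n\<close> fixes all indices below \<open>n\<close>, so this is
    the plain inclusion of \<open>K3 t\<close>.\<close>
  let ?\<psi> = "(\<lambda>(p, i). (p, skip n i)) \<circ> \<phi>"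
  have "copy_in H (K3 n) ?\<psi>"
    using copy_in_trans[OF assms(1) copy_in_K3_skip[OF assms(3), of "\<lambda>_. n"]] .
  moreover have "\<phi> ` e = edge_of 0 0 0" if "e \<in> edges H" for e
  proof -
    have "\<phi> ` e \<in> edges (K3 t)" using assms(1) \<open>e \<in> edges H\<close> unfolding copy_in_def by blast
    then obtain i j k where "\<phi> ` e = edge_of i j k" "i < t" "j < t" "k < t"
      unfolding edges_K3 by blast
    moreover from this assms(2) have "i = 0" "j = 0" "k = 0" by simp_all
    ultimately show ?thesis by simp
  qed
  then have "\<forall>e\<in>edges H. \<chi> (?\<psi> ` e) = \<chi> ((\<lambda>(p, i). (p, skip n i)) ` edge_of 0 0 0)"
    unfolding image_comp[symmetric] by simp
  ultimately show ?thesis unfolding has_mono_copy_def by blast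
qed

lemma mono_copy_of_two_colours:
  assumes R: "\<forall>\<chi> \<in> edges K \<rightarrow> {..<2}. has_mono_copy H K \<chi>"
    and kl: "\<And>e. e \<in> edges K \<Longrightarrow> \<chi> e = k \<or> \<chi> e = l"
  shows "has_mono_copy H K \<chi>"
proof -
  define \<chi>' where "\<chi>' e = (if \<chi> e = k then 0 else 1 :: nat)" for e
  have "\<chi>' \<in> edges K \<rightarrow> {..<2}" unfolding \<chi>'_def by auto
  then obtain \<phi> m where *: "copy_in H K \<phi>" "\<forall>e\<in>edges H. \<chi>' (\<phi> ` e) = m"
    using R unfolding has_mono_copy_def by blast
  then have "\<forall>e\<in>edges H. \<chi> (\<phi> ` e) = (if m = 0 then k else l)"
    using kl unfolding copy_in_def \<chi>'_def by (metis one_neq_zero)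
  then show ?thesis using *(1) unfolding has_mono_copy_def by blast
qed

lemma mono_or_rainbow:
  assumes \<phi>: "copy_in H (K3 t) \<phi>" "t + 1 \<le> n"
    and R: "\<forall>\<chi> \<in> edges (K3 n) \<rightarrow> {..<2}. has_mono_copy H (K3 n) \<chi>"
  shows "has_mono_copy H (K3 n) \<chi> \<or> has_rainbow_copy loose_path (K3 n) \<chi>"
proof (rule disjCI)
  assume nr: "\<not> has_rainbow_copy loose_path (K3 n) \<chi>"
  show "has_mono_copy H (K3 n) \<chi>"
  proof (cases "\<exists>k l. \<forall>e\<in>edges (K3 n). \<chi> e = k \<or> \<chi> e = l")
    case True
    then show ?thesis using mono_copy_of_two_colours[OF R] by metis
  next
    case False
    show ?thesis
    \<comment> \<open>The three-colour argument needs three indices in each part;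
      \<open>t + 1 \<le> n\<close> provides them once \<open>t \<ge> 2\<close>.\<close>
    proof (cases "t \<le> 1")
      case True
      then show ?thesis using mono_copy_of_le_1 \<phi> by blast
    next
      case t: False
      have "mono_off_edge {..<n} (\<lambda>i j k. \<chi> (edge_of i j k))"
      proof (rule mono_off_edge_of_three_colours[OF loose_free_of_no_rainbow_copy[OF nr]])
        show "\<exists>p\<in>{..<n}. \<exists>q\<in>{..<n}. \<exists>r\<in>{..<n}. distinct [p, q, r]"
          using t \<phi>(2) by (intro bexI[of _ 0] bexI[of _ 1] bexI[of _ 2]) auto
        show "\<exists>x\<in>{..<n}. \<exists>y\<in>{..<n}. \<exists>z\<in>{..<n}. \<chi> (edge_of x y z) \<noteq> k \<and> \<chi> (edge_of x y z) \<noteq> l" for k l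
          using False unfolding edges_K3 by blast
      qed
      then show ?thesis using mono_copy_of_mono_off_edge \<phi> by blast
    qed
  qed
qed

section \<open>Comparison of the two minima\<close>

text \<open>The empty set has infimum \<infinity>, so a finite value comes from a nonempty set,
  whose infimum is its least element.\<close>

lemma Inf_enat_attained:
  assumes "Inf {enat n | n. P n} = enat m"
  shows "P m"
proof -
  have "{enat n | n. P n} \<noteq> {}"
    using assms by (metis Inf_enat_def enat.distinct(1))
  then have "Inf {enat n | n. P n} \<in> {enat n | n. P n}"
    unfolding Inf_enat_def by (auto intro: LeastI)
  then show ?thesis using assms by auto
qed

theorem theorem1p18:
  fixes H :: "'a hypergraph"
  assumes "three_graph H" and "three_partite H"
    and "R2' H \<ge> t_par H + 1"
  shows "f' H loose_path = R2' H"
proof (rule antisym)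
  show "R2' H \<le> f' H loose_path"
    unfolding R2'_def f'_def
    by (rule Inf_superset_mono) (use no_rainbow_copy_two_colours in blast)
  show "f' H loose_path \<le> R2' H"
  proof (cases "R2' H")
    case (enat n)
    then have R: "\<forall>\<chi> \<in> edges (K3 n) \<rightarrow> {..<2}. has_mono_copy H (K3 n) \<chi>"
      unfolding R2'_def by (rule Inf_enat_attained)
    \<comment> \<open>A finite \<open>R2' H\<close> bounds \<open>t_par H\<close>, so the latter is
      finite as well and is attained by an embedding.\<close>
    obtain t where t: "t_par H = enat t" "t + 1 \<le> n"
      using assms(3) enat by (cases "t_par H") (auto simp: one_enat_def)
    obtain \<phi> where "copy_in H (K3 t) \<phi>"
      using Inf_enat_attained[OF t(1)[unfolded t_par_def]] by blast
    then have "has_mono_copy H (K3 n) \<chi> \<or> has_rainbow_copy loose_path (K3 n) \<chi>" for \<chi>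
      using mono_or_rainbow t(2) R by blast
    then show ?thesis unfolding enat f'_def by (intro Inf_lower) blast
  qed simp
qed

end
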